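(* Let $\mathbb{X}$ and $\mathbb{Y}$ be Hausdorff topological spaces. Assume that: (a) $\mathbb{X}$ is compactly generated; (b) $\Phi:\mathbb{X}\to 2^{\mathbb{Y}}\setminus\{\emptyset\}$ is a lower semi-continuous set-valued mapping; (c) $u:\mathbb{X}\times\mathbb{Y}\to\mathbb{R}$ is $\mathbb{K}$-inf-compact on $\mathrm{Gr}_{\mathbb{X}}(\Phi)$ and upper semi-continuous on $\mathrm{Gr}_{\mathbb{X}}(\Phi)$. Define $v(x):=\inf_{y\in\Phi(x)}u(x,y)$ and $\Phi^*(x):=\{y\in\Phi(x): v(x)=u(x,y)\}$ for $x\in\mathbb{X}$. Then $v$ takes values in $\mathbb{R}$ and $v:\mathbb{X}\to\mathbb{R}$ is continuous, and the set-valued mapping $\Phi^*$ has nonempty compact values and is upper semi-continuous.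
   Context: A topological space $\mathbb{X}$ is compactly generated if a set $A\subseteq\mathbb{X}$ is closed in $\mathbb{X}$ whenever $A\cap K$ is closed in $K$ for every nonempty compact $K\subseteq\mathbb{X}$. A set-valued mapping $F$ from $\mathbb{X}$ to the nonempty subsets of $\mathbb{Y}$ is upper semi-continuous at $x$ if for every neighborhood $\mathcal{G}$ of the set $F(x)$ there is a neighborhood $\mathcal{O}(x)$ of $x$ with $F(z)\subseteq\mathcal{G}$ for all $z\in\mathcal{O}(x)$. It is lower semi-continuous at $x$ if for every open $\mathcal{G}$ with $F(x)\cap\mathcal{G}\neq\emptyset$ there is a neighborhood $\mathcal{O}(x)$ of $x$ with $F(z)\cap\mathcal{G}\neq\emptyset$ for all $z\in\mathcal{O}(x)$. It is upper (lower) semi-continuous if it is so at every $x\in\mathbb{X}$. For $Z\subseteq\mathbb{X}$, $\mathrm{Gr}_Z(\Phi)=\{(x,y)\in Z\times\mathbb{Y}: y\in\Phi(x)\}$. For an extended-real-valued function $f$ on a nonempty subset $U$ of a topological space and $\lambda\in\mathbb{R}$, let $\mathcal{D}_f(\lambda;U)=\{y\in U: f(y)\le\lambda\}$. The function $f$ is lower semi-continuous on $U$ if all sets $\mathcal{D}_f(\lambda;U)$, $\lambda\in\mathbb{R}$, are closed (in the subspace topology of $U$), upper semi-continuous on $U$ if $-f$ is lower semi-continuous on $U$, and inf-compact on $U$ if all sets $\mathcal{D}_f(\lambda;U)$, $\lambda\in\mathbb{R}$, are compact. A function $u$ on $\mathbb{X}\times\mathbb{Y}$ is $\mathbb{K}$-inf-compact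 on $\mathrm{Gr}_{\mathbb{X}}(\Phi)$ if for every nonempty compact $K\subseteq\mathbb{X}$ it is inf-compact on $\mathrm{Gr}_K(\Phi)$. *)

theory Defs
  imports "HOL-Analysis.Analysis"
begin

text \<open>
  Topological spaces are types of class \<^class>\<open>t2_space\<close> (the Hausdorff spaces). ``Compactly
  generated'' is the library's \<^const>\<open>k_space\<close> applied to \<^const>\<open>euclidean\<close>, which is the
  topology of the type class (not a Euclidean space); the next lemma unfolds it.
\<close>

lemma k_space_euclidean_iff:
  "k_space (euclidean :: 'a::topological_space topology) \<longleftrightarrow>
     (\<forall>A :: 'a set. (\<forall>K. compact K \<and> K \<noteq> {} \<longrightarrow> closedin (top_of_set K) (A \<inter> K)) \<longrightarrow> closed A)"
proof -
  have k: "k_space (euclidean :: 'a topology) \<longleftrightarrow>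
     (\<forall>A :: 'a set. closed A \<longleftrightarrow> (\<forall>K. compact K \<longrightarrow> closedin (top_of_set K) (K \<inter> A)))"
    by (simp add: k_space_def)
  have eq: "(\<forall>K. compact K \<longrightarrow> closedin (top_of_set K) (K \<inter> A)) \<longleftrightarrow>
        (\<forall>K. compact K \<and> K \<noteq> {} \<longrightarrow> closedin (top_of_set K) (A \<inter> K))" (is "?l \<longleftrightarrow> ?r")
    for A :: "'a set"
  proof
    show ?r if ?l
      using that by (simp add: Int_commute)
    show ?l if r: ?r
    proof (intro allI impI)
      fix K :: "'a set"
      assume "compact K"
      then show "closedin (top_of_set K) (K \<inter> A)"
        using r[rule_format, of K] by (cases "K = {}") (simp_all add: Int_commute)
    qed
  qed
  have cl: "\<forall>K. compact K \<longrightarrow> closedin (top_of_set K) (K \<inter> A)" if "closed A" for A :: "'a set"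
    using that by (simp add: closedin_closed_Int)
  show ?thesis
    unfolding k eq[symmetric] by (intro iff_allI iffI) (use cl in \<open>simp_all\<close>)
qed

subsection \<open>Semi-continuity of set-valued mappings\<close>

definition set_usc_at :: "('a::topological_space \<Rightarrow> 'b::topological_space set) \<Rightarrow> 'a \<Rightarrow> bool" where
  "set_usc_at F x \<longleftrightarrow>
     (\<forall>G. open G \<and> F x \<subseteq> G \<longrightarrow> (\<exists>V. open V \<and> x \<in> V \<and> (\<forall>z\<in>V. F z \<subseteq> G)))"

definition set_lsc_at :: "('a::topological_space \<Rightarrow> 'b::topological_space set) \<Rightarrow> 'a \<Rightarrow> bool" where
  "set_lsc_at F x \<longleftrightarrow>
     (\<forall>G. open G \<and> F x \<inter> G \<noteq> {} \<longrightarrow> (\<exists>V. open V \<and> x \<in> V \<and> (\<forall>z\<in>V. F z \<inter> G \<noteq> {})))"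

definition set_usc :: "('a::topological_space \<Rightarrow> 'b::topological_space set) \<Rightarrow> bool" where
  "set_usc F \<longleftrightarrow> (\<forall>x. set_usc_at F x)"

definition set_lsc :: "('a::topological_space \<Rightarrow> 'b::topological_space set) \<Rightarrow> bool" where
  "set_lsc F \<longleftrightarrow> (\<forall>x. set_lsc_at F x)"

subsection \<open>Extended-real-valued functions on subsets\<close>

definition level_set :: "('a \<Rightarrow> ereal) \<Rightarrow> real \<Rightarrow> 'a set \<Rightarrow> 'a set" where
  "level_set f r U = {y \<in> U. f y \<le> ereal r}"

definition lsc_on :: "'a::topological_space set \<Rightarrow> ('a \<Rightarrow> ereal) \<Rightarrow> bool" where
  "lsc_on U f \<longleftrightarrow> (\<forall>r. closedin (top_of_set U) (level_set f r U))"

definition usc_on :: "'a::topological_space set \<Rightarrow> ('a \<Rightarrow> ereal) \<Rightarrow> bool" where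
  "usc_on U f \<longleftrightarrow> lsc_on U (\<lambda>y. - f y)"

definition inf_compact_on :: "'a::topological_space set \<Rightarrow> ('a \<Rightarrow> ereal) \<Rightarrow> bool" where
  "inf_compact_on U f \<longleftrightarrow> (\<forall>r. compact (level_set f r U))"

definition Gr :: "'a set \<Rightarrow> ('a \<Rightarrow> 'b set) \<Rightarrow> ('a \<times> 'b) set" where
  "Gr Z \<Phi> = {(x, y). x \<in> Z \<and> y \<in> \<Phi> x}"

definition K_inf_compact ::
  "('a::topological_space \<Rightarrow> 'b::topological_space set) \<Rightarrow> ('a \<times> 'b \<Rightarrow> ereal) \<Rightarrow> bool" where
  "K_inf_compact \<Phi> u \<longleftrightarrow> (\<forall>K. compact K \<and> K \<noteq> {} \<longrightarrow> inf_compact_on (Gr K \<Phi>) u)"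

subsection \<open>Value function and solution multifunction\<close>

text \<open>
  The infimum is taken in \<^typ>\<open>ereal\<close>, so that finiteness of the value function is a genuine
  claim: on \<^typ>\<open>real\<close>, \<^const>\<open>Inf\<close> of a set unbounded below is an unspecified real number.
\<close>

definition value_fun :: "('a \<Rightarrow> 'b set) \<Rightarrow> ('a \<times> 'b \<Rightarrow> ereal) \<Rightarrow> 'a \<Rightarrow> ereal" where
  "value_fun \<Phi> u x = (INF y \<in> \<Phi> x. u (x, y))"

definition solution_set :: "('a \<Rightarrow> 'b set) \<Rightarrow> ('a \<times> 'b \<Rightarrow> ereal) \<Rightarrow> 'a \<Rightarrow> 'b set" where
  "solution_set \<Phi> u x = {y \<in> \<Phi> x. value_fun \<Phi> u x = u (x, y)}"

end

theory Submission
  imports Defs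
begin

text \<open>
  Write \<open>v\<close> for the value function and \<open>\<Phi>\<^sup>*\<close> for the solution multifunction.

  Over a singleton \<open>{x}\<close> the level sets of \<open>u\<close> form a chain of compact sets, so the infimum \<open>v x\<close>
  is attained (\<open>solution_set_nonempty\<close>). As \<open>u\<close> is real-valued, \<open>v\<close> is finite, and
  \<open>\<Phi>\<^sup>* x\<close> is the projection of the compact level set of height \<open>v x\<close>.

  Upper semi-continuity of \<open>v\<close> (\<open>value_fun_less_eventually\<close>) is local: any \<open>y \<in> \<Phi> x\<close> with
  \<open>u (x, y) < c\<close> has a product neighbourhood \<open>V \<times> W\<close> of \<open>(x, y)\<close> such that \<open>u < c\<close> on the part
  of the graph inside it, and by lower semi-continuity of \<open>\<Phi>\<close> the sets \<open>\<Phi> z\<close>, for \<open>z\<close>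
  near \<open>x\<close>, all meet \<open>W\<close>.

  Lower semi-continuity of \<open>v\<close> and upper semi-continuity of \<open>\<Phi>\<^sup>*\<close> both assert that a certain set
  \<open>A\<close> of parameters is closed, namely \<open>{x. v x \<le> r}\<close> and \<open>{x. \<Phi>\<^sup>* x \<inter> F \<noteq> {}}\<close> with \<open>F\<close> closed.
  In a compactly generated Hausdorff space it suffices that \<open>A \<inter> K\<close> is compact for each
  nonempty compact \<open>K\<close>. In both cases \<open>A \<inter> K\<close> is the projection of a compact part of the graph
  over \<open>K\<close>: for \<open>v\<close> a level set of \<open>u\<close>, since minima are attained; for \<open>\<Phi>\<^sup>*\<close> the set
  \<open>{(x, y). y \<in> F \<and> u (x, y) \<le> v x}\<close>, which lies inside one level set because the continuous \<open>v\<close>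
  is bounded above on \<open>K\<close>, and is closed there because \<open>u\<close> is lower semi-continuous over \<open>K\<close> and
  \<open>v\<close> is continuous.
\<close>

section \<open>Compactness in the parameter space and in the graph\<close>

lemma closed_if_Int_compact_sets:
  fixes A :: "'a::t2_space set"
  assumes "k_space (euclidean :: 'a topology)"
    and "\<And>K. compact K \<Longrightarrow> K \<noteq> {} \<Longrightarrow> compact (A \<inter> K)"
  shows "closed A"
  using assms unfolding k_space_euclidean_iff
  by (meson closed_subset compact_imp_closed inf_le2)

lemma compact_fst_image: "compact M \<Longrightarrow> compact (fst ` M)"
  by (intro compact_continuous_image continuous_intros)

lemma compact_level_set:
  assumes "K_inf_compact \<Phi> u" "compact K" "K \<noteq> {}"
  shows "compact (level_set u r (Gr K \<Phi>))"
  using assms by (auto simp: K_inf_compact_def inf_compact_on_def)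

lemma value_fun_le: "y \<in> \<Phi> x \<Longrightarrow> value_fun \<Phi> u x \<le> u (x, y)"
  unfolding value_fun_def by (rule INF_lower)

lemma mem_solution_set_iff:
  "y \<in> solution_set \<Phi> u x \<longleftrightarrow> y \<in> \<Phi> x \<and> u (x, y) \<le> value_fun \<Phi> u x"
  using value_fun_le[of y \<Phi> x u] by (auto simp: solution_set_def)

section \<open>Attainment of the infimum\<close>

text \<open>
  The level sets of height \<open>r > v x\<close> over \<open>{x}\<close> are nonempty, compact and nested; a common point is
  a minimiser. The hypothesis \<open>v x < \<infinity>\<close> provides at least one such real height.
\<close>

lemma solution_set_nonempty:
  fixes \<Phi> :: "'a::t2_space \<Rightarrow> 'b::t2_space set"
  assumes u: "K_inf_compact \<Phi> u" and fin: "value_fun \<Phi> u x < \<infinity>"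
  shows "solution_set \<Phi> u x \<noteq> {}"
proof -
  let ?v = "value_fun \<Phi> u x"
  define L where "L r = level_set u r (Gr {x} \<Phi>)" for r
  have L_compact: "compact (L r)" for r
    unfolding L_def by (rule compact_level_set[OF u]) auto
  have L_nonempty: "L r \<noteq> {}" if less: "?v < ereal r" for r
  proof -
    obtain y where "y \<in> \<Phi> x" "u (x, y) < ereal r"
      using less by (auto simp: value_fun_def INF_less_iff)
    then have "(x, y) \<in> L r"
      by (auto simp: L_def level_set_def Gr_def)
    then show ?thesis by blast
  qed
  have L_mono: "L r \<subseteq> L s" if "r \<le> s" for r s
    using that by (force simp: L_def level_set_def intro: order_trans)
  obtain r0 where r0: "?v < ereal r0"
    using ereal_dense2[OF fin] by blast
  define R where "R = {r. ?v < ereal r}"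
  have "L r0 \<inter> (\<Inter>r\<in>R. L r) \<noteq> {}"
  proof (rule compact_imp_fip_image[OF L_compact])
    show "closed (L r)" for r
      by (rule compact_imp_closed[OF L_compact])
    fix I assume I: "finite I" "I \<subseteq> R"
    define m where "m = Min (insert r0 I)"
    have "m \<in> insert r0 I" unfolding m_def by (rule Min_in) (use I in auto)
    then have "L m \<noteq> {}" using I r0 by (intro L_nonempty) (auto simp: R_def)
    moreover have "m \<le> r" if "r \<in> insert r0 I" for r
      unfolding m_def using I that by (intro Min_le) auto
    then have "L m \<subseteq> L r0 \<inter> (\<Inter>r\<in>I. L r)"
      using L_mono by blast
    ultimately show "L r0 \<inter> (\<Inter>r\<in>I. L r) \<noteq> {}" by blast
  qed
  then obtain y where y: "(x, y) \<in> L r0" "\<And>r. r \<in> R \<Longrightarrow> (x, y) \<in> L r"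
    by (fastforce simp: L_def level_set_def Gr_def)
  have "u (x, y) \<le> ?v"
  proof (rule ccontr)
    assume "\<not> u (x, y) \<le> ?v"
    then obtain q where "?v < ereal q" "ereal q < u (x, y)"
      using ereal_dense2[of ?v "u (x, y)"] by (auto simp: not_le)
    then show False using y(2)[of q] by (auto simp: R_def L_def level_set_def)
  qed
  moreover have "y \<in> \<Phi> x" using y(1) by (auto simp: L_def level_set_def Gr_def)
  ultimately show ?thesis by (auto simp: mem_solution_set_iff)
qed

lemma compact_solution_set:
  fixes \<Phi> :: "'a::t2_space \<Rightarrow> 'b::t2_space set"
  assumes u: "K_inf_compact \<Phi> u" and fin: "\<bar>value_fun \<Phi> u x\<bar> \<noteq> \<infinity>"
  shows "compact (solution_set \<Phi> u x)"
proof -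
  obtain r where r: "value_fun \<Phi> u x = ereal r" using fin by auto
  have "compact (level_set u r (Gr {x} \<Phi>))"
    by (rule compact_level_set[OF u]) auto
  then have "compact (snd ` level_set u r (Gr {x} \<Phi>))"
    by (intro compact_continuous_image continuous_intros)
  also have "snd ` level_set u r (Gr {x} \<Phi>) = solution_set \<Phi> u x"
    by (force simp: mem_solution_set_iff r level_set_def Gr_def image_iff)
  finally show ?thesis .
qed

section \<open>Continuity of the value function\<close>

lemma value_fun_less_eventually:
  fixes \<Phi> :: "'a::topological_space \<Rightarrow> 'b::topological_space set"
  assumes \<Phi>: "set_lsc \<Phi>" and u: "usc_on (Gr UNIV \<Phi>) u" and less: "value_fun \<Phi> u x < c"
  shows "\<exists>V. open V \<and> x \<in> V \<and> (\<forall>z\<in>V. value_fun \<Phi> u z < c)"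
proof -
  obtain y where y: "y \<in> \<Phi> x" "u (x, y) < c"
    using less by (auto simp: value_fun_def INF_less_iff)
  obtain r where r: "u (x, y) < ereal r" "ereal r < c"
    using ereal_dense2[OF y(2)] by blast
  have "closedin (top_of_set (Gr UNIV \<Phi>)) (level_set (\<lambda>p. - u p) (- r) (Gr UNIV \<Phi>))"
    using u by (auto simp: usc_on_def lsc_on_def)
  then obtain C where C: "closed C" "level_set (\<lambda>p. - u p) (- r) (Gr UNIV \<Phi>) = Gr UNIV \<Phi> \<inter> C"
    by (auto simp: closedin_closed)
  have C_iff: "p \<in> C \<longleftrightarrow> ereal r \<le> u p" if "p \<in> Gr UNIV \<Phi>" for p
    using C(2) that ereal_minus_le_minus[of "u p" "ereal r"] by (auto simp: level_set_def)
  have "(x, y) \<in> - C"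
    using C_iff[of "(x, y)"] y r by (auto simp: Gr_def)
  moreover have "open (- C)" using C(1) by (simp add: open_Compl)
  ultimately obtain V W where VW: "open V" "open W" "x \<in> V" "y \<in> W" "V \<times> W \<subseteq> - C"
    by (elim open_prod_elim) auto
  obtain V' where V': "open V'" "x \<in> V'" "\<And>z. z \<in> V' \<Longrightarrow> \<Phi> z \<inter> W \<noteq> {}"
    using \<Phi> VW y(1) unfolding set_lsc_def set_lsc_at_def by (metis disjoint_iff)
  have "value_fun \<Phi> u z < c" if z: "z \<in> V \<inter> V'" for z
  proof -
    obtain w where w: "w \<in> \<Phi> z" "w \<in> W" using V'(3) z by blast
    then have "u (z, w) < ereal r"
      using C_iff[of "(z, w)"] VW(5) z by (auto simp: Gr_def not_le[symmetric])
    then show ?thesis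
      using value_fun_le[of w \<Phi> z u] w(1) r(2) by (meson less_trans le_less_trans)
  qed
  then show ?thesis
    using VW V' by (intro exI[of _ "V \<inter> V'"]) auto
qed

text \<open>
  Over a compact \<open>K\<close> the sublevel set of \<open>v\<close> is the projection of the level set of \<open>u\<close> of the same
  height; attainment of the infimum gives one inclusion.
\<close>

lemma closed_value_fun_le:
  fixes \<Phi> :: "'a::t2_space \<Rightarrow> 'b::t2_space set"
  assumes k: "k_space (euclidean :: 'a topology)" and u: "K_inf_compact \<Phi> u"
  shows "closed {x. value_fun \<Phi> u x \<le> ereal r}"
proof (rule closed_if_Int_compact_sets[OF k])
  fix K :: "'a set" assume K: "compact K" "K \<noteq> {}"
  have "{x. value_fun \<Phi> u x \<le> ereal r} \<inter> K = fst ` level_set u r (Gr K \<Phi>)"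
  proof (intro subset_antisym subsetI)
    fix x assume x: "x \<in> {x. value_fun \<Phi> u x \<le> ereal r} \<inter> K"
    then have "value_fun \<Phi> u x < \<infinity>" by auto
    then obtain y where "y \<in> \<Phi> x" "u (x, y) \<le> value_fun \<Phi> u x"
      using solution_set_nonempty[OF u, of x] unfolding ex_in_conv[symmetric] mem_solution_set_iff
      by blast
    then have "(x, y) \<in> level_set u r (Gr K \<Phi>)"
      using x by (auto simp: level_set_def Gr_def)
    then show "x \<in> fst ` level_set u r (Gr K \<Phi>)" by force
  qed (auto simp: level_set_def Gr_def intro: order_trans[OF value_fun_le])
  then show "compact ({x. value_fun \<Phi> u x \<le> ereal r} \<inter> K)"
    using compact_fst_image[OF compact_level_set[OF u K]] by simp
qed

lemma continuous_value_fun: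
  fixes \<Phi> :: "'a::t2_space \<Rightarrow> 'b::t2_space set"
  assumes k: "k_space (euclidean :: 'a topology)" and \<Phi>: "set_lsc \<Phi>"
    and u: "K_inf_compact \<Phi> u" "usc_on (Gr UNIV \<Phi>) u"
  shows "continuous_on UNIV (value_fun \<Phi> u)"
  unfolding continuous_on_def
proof (intro ballI order_tendstoI)
  fix x c assume "c < value_fun \<Phi> u x"
  then obtain r where r: "c < ereal r" "ereal r < value_fun \<Phi> u x"
    using ereal_dense2 by blast
  have "open (- {z. value_fun \<Phi> u z \<le> ereal r})"
    using closed_value_fun_le[OF k u(1)] by (simp add: open_Compl)
  moreover have "c < value_fun \<Phi> u z" if "z \<in> - {z. value_fun \<Phi> u z \<le> ereal r}" for z
    using that r(1) by auto
  ultimately show "eventually (\<lambda>z. c < value_fun \<Phi> u z) (at x)"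
    using r(2) unfolding eventually_at_topological by (metis ComplI mem_Collect_eq not_le)
next
  fix x c assume "value_fun \<Phi> u x < c"
  from value_fun_less_eventually[OF \<Phi> u(2) this]
  show "eventually (\<lambda>z. value_fun \<Phi> u z < c) (at x)"
    unfolding eventually_at_topological by blast
qed

section \<open>Upper semi-continuity of the solution multifunction\<close>

lemma set_uscI_closed:
  assumes "\<And>F. closed F \<Longrightarrow> closed {x. \<Psi> x \<inter> F \<noteq> {}}"
  shows "set_usc \<Psi>"
  unfolding set_usc_def set_usc_at_def
proof (intro allI impI, elim conjE)
  fix x G assume G: "open G" "\<Psi> x \<subseteq> G"
  have "open (- {x. \<Psi> x \<inter> - G \<noteq> {}})"
    using assms[of "- G"] G(1) by (simp add: open_Compl closed_Compl)
  then show "\<exists>V. open V \<and> x \<in> V \<and> (\<forall>z\<in>V. \<Psi> z \<subseteq> G)"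
    using G(2) by (intro exI[of _ "- {x. \<Psi> x \<inter> - G \<noteq> {}}"]) auto
qed

text \<open>
  Let \<open>r\<close> bound \<open>v\<close> from above on \<open>K\<close>. The condition \<open>u (x, y) \<le> v x\<close> holds iff every real
  \<open>q\<close> satisfies \<open>u (x, y) \<le> q\<close> or \<open>q \<le> v x\<close>. This presents the part of the graph of \<open>\<Phi>\<^sup>*\<close> over \<open>K\<close>
  as the intersection of one compact level set with closed sets.
\<close>

lemma compact_solution_graph:
  fixes \<Phi> :: "'a::t2_space \<Rightarrow> 'b::t2_space set"
  assumes u: "K_inf_compact \<Phi> u" and v: "continuous_on UNIV (value_fun \<Phi> u)"
    and fin: "\<And>x. value_fun \<Phi> u x < \<infinity>"
    and K: "compact K" "K \<noteq> {}"
  shows "compact (Gr K (solution_set \<Phi> u))"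
proof -
  define L where "L r = level_set u r (Gr K \<Phi>)" for r
  have L_compact: "compact (L r)" for r
    unfolding L_def by (rule compact_level_set[OF u K])
  obtain x0 where x0: "x0 \<in> K" "\<And>x. x \<in> K \<Longrightarrow> value_fun \<Phi> u x \<le> value_fun \<Phi> u x0"
    using continuous_attains_sup[OF K continuous_on_subset[OF v]] by blast
  obtain r where "value_fun \<Phi> u x0 < ereal r"
    using ereal_dense2[OF fin] by blast
  then have r: "value_fun \<Phi> u x \<le> ereal r" if "x \<in> K" for x
    using x0(2)[OF that] by order
  define B where "B q = L q \<union> {x. ereal q \<le> value_fun \<Phi> u x} \<times> UNIV" for q
  have "closed {x. ereal q \<le> value_fun \<Phi> u x}" for q
    by (intro closed_Collect_le continuous_intros v)
  then have B_closed: "closed (B q)" for q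
    unfolding B_def by (intro closed_Un closed_Times compact_imp_closed[OF L_compact]) auto
  have B_iff: "u (x, y) \<le> value_fun \<Phi> u x \<longleftrightarrow> (\<forall>q. (x, y) \<in> B q)"
    if "(x, y) \<in> Gr K \<Phi>" for x y
  proof
    assume "u (x, y) \<le> value_fun \<Phi> u x"
    then show "\<forall>q. (x, y) \<in> B q"
      using that by (auto simp: B_def L_def level_set_def)
  next
    assume *: "\<forall>q. (x, y) \<in> B q"
    show "u (x, y) \<le> value_fun \<Phi> u x"
    proof (rule ccontr)
      assume "\<not> u (x, y) \<le> value_fun \<Phi> u x"
      then obtain q where "value_fun \<Phi> u x < ereal q" "ereal q < u (x, y)"
        using ereal_dense2[of "value_fun \<Phi> u x" "u (x, y)"] by (auto simp: not_le)
      then show False using *[rule_format, of q] by (auto simp: B_def L_def level_set_def)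
    qed
  qed
  have "Gr K (solution_set \<Phi> u) = L r \<inter> (\<Inter>q. B q)"
  proof (intro set_eqI)
    fix p :: "'a \<times> 'b"
    obtain x y where p: "p = (x, y)" by (cases p)
    have "p \<in> Gr K (solution_set \<Phi> u) \<longleftrightarrow> (x, y) \<in> Gr K \<Phi> \<and> u (x, y) \<le> value_fun \<Phi> u x"
      by (auto simp: p Gr_def mem_solution_set_iff)
    also have "\<dots> \<longleftrightarrow> (x, y) \<in> L r \<and> u (x, y) \<le> value_fun \<Phi> u x"
      using r[of x] by (auto simp: L_def level_set_def Gr_def)
    also have "\<dots> \<longleftrightarrow> p \<in> L r \<inter> (\<Inter>q. B q)"
      using B_iff[of x y] by (auto simp: p L_def level_set_def)
    finally show "p \<in> Gr K (solution_set \<Phi> u) \<longleftrightarrow> p \<in> L r \<inter> (\<Inter>q. B q)" .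
  qed
  moreover have "compact (L r \<inter> (\<Inter>q. B q))"
    by (intro compact_Int_closed L_compact closed_INT ballI B_closed)
  ultimately show ?thesis by simp
qed

lemma set_usc_solution_set:
  fixes \<Phi> :: "'a::t2_space \<Rightarrow> 'b::t2_space set"
  assumes k: "k_space (euclidean :: 'a topology)"
    and u: "K_inf_compact \<Phi> u" and v: "continuous_on UNIV (value_fun \<Phi> u)"
    and fin: "\<And>x. value_fun \<Phi> u x < \<infinity>"
  shows "set_usc (solution_set \<Phi> u)"
proof (rule set_uscI_closed, rule closed_if_Int_compact_sets[OF k])
  fix F :: "'b set" and K :: "'a set"
  assume F: "closed F" and K: "compact K" "K \<noteq> {}"
  have "{x. solution_set \<Phi> u x \<inter> F \<noteq> {}} \<inter> K = fst ` (Gr K (solution_set \<Phi> u) \<inter> UNIV \<times> F)"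
    by (force simp: Gr_def image_iff)
  moreover have "compact (fst ` (Gr K (solution_set \<Phi> u) \<inter> UNIV \<times> F))"
    by (intro compact_fst_image compact_Int_closed compact_solution_graph[OF u v fin K]
          closed_Times F closed_UNIV)
  ultimately show "compact ({x. solution_set \<Phi> u x \<inter> F \<noteq> {}} \<inter> K)" by simp
qed

theorem theorem1p2:
  fixes \<Phi> :: "'a::t2_space \<Rightarrow> 'b::t2_space set"
    and u :: "'a \<times> 'b \<Rightarrow> real"
  defines "v \<equiv> value_fun \<Phi> (\<lambda>p. ereal (u p))"
    and "\<Phi>s \<equiv> solution_set \<Phi> (\<lambda>p. ereal (u p))"
  assumes "k_space (euclidean :: 'a topology)"
    and "\<forall>x. \<Phi> x \<noteq> {}"
    and "set_lsc \<Phi>"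
    and "K_inf_compact \<Phi> (\<lambda>p. ereal (u p))"
    and "usc_on (Gr UNIV \<Phi>) (\<lambda>p. ereal (u p))"
  shows "(\<forall>x. \<bar>v x\<bar> \<noteq> \<infinity>) \<and> continuous_on UNIV (\<lambda>x. real_of_ereal (v x)) \<and>
         (\<forall>x. \<Phi>s x \<noteq> {} \<and> compact (\<Phi>s x)) \<and> set_usc \<Phi>s"
proof -
  have less: "v x < \<infinity>" for x
  proof -
    obtain y where "y \<in> \<Phi> x" using assms(4) by blast
    then show ?thesis
      unfolding v_def by (rule value_fun_le[THEN le_less_trans]) simp
  qed
  have nonempty: "\<Phi>s x \<noteq> {}" for x
    using solution_set_nonempty[OF assms(6)] less unfolding v_def \<Phi>s_def by blast
  \<comment> \<open>The infimum equals an attained value of \<open>u\<close>, which is real.\<close>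
  have fin: "\<bar>v x\<bar> \<noteq> \<infinity>" for x
    using nonempty[of x] by (auto simp: v_def \<Phi>s_def solution_set_def)
  have cont: "continuous_on UNIV v"
    unfolding v_def by (rule continuous_value_fun[OF assms(3,5,6,7)])
  have "range v \<subseteq> UNIV - {\<infinity>, - \<infinity>}"
  proof (intro image_subsetI)
    fix x
    show "v x \<in> UNIV - {\<infinity>, - \<infinity>}" using fin[of x] by auto
  qed
  then have "continuous_on UNIV (\<lambda>x. real_of_ereal (v x))"
    by (rule continuous_on_compose2[OF continuous_on_real cont])
  moreover have "compact (\<Phi>s x)" for x
    unfolding \<Phi>s_def by (rule compact_solution_set[OF assms(6) fin[unfolded v_def]])
  moreover have "set_usc \<Phi>s"
    unfolding \<Phi>s_def
    by (rule set_usc_solution_set[OF assms(3,6) cont[unfolded v_def] less[unfolded v_def]])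
  ultimately show ?thesis using fin nonempty by simp
qed

end
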